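(* Let $(G,F)$ be a GIFS on $\mathbb{R}^d$ and let $\overleftarrow{\theta}\in\overleftarrow{\Sigma}^{\infty}$ be a parameter. If $\overleftarrow{\theta}$ is filling, then $T(\overleftarrow{\theta},\mathcal{S})$ is a tiling of $\mathbb{R}^d$ for every $\overleftarrow{\theta}$-sequence $\mathcal{S}=\{S_0,S_1,S_2,\dots\}$.
   Context: GIFS. Let $G=(V,E)$ be a finite strongly connected directed graph with $V=\{1,\dots,n\}$, loops and multiple edges allowed. An edge $e$ goes from its tail $e^-$ to its head $e^+$, and $E_i=\{e\in E: e^-=i\}$. A path is directed, is written as its string of edges, may repeat vertices and edges, and may have length zero (a single vertex); $\sigma^-$ is its starting vertex and, for finite $\sigma$, $\sigma^+$ is its terminal vertex. $\Sigma^*$ is the set of finite paths in $G$. A GIFS $(G,F)$ on $\mathbb{R}^d$ consists of $G$ and an invertible contraction $f_e:\mathbb{R}^d\to\mathbb{R}^d$ for each $e\in E$. For $\sigma=\sigma_1\cdots\sigma_k\in\Sigma^*$ put $f_\sigma=f_{\sigma_1}\circ\cdots\circ f_{\sigma_k}$ (the identity if $k=0$). There is a unique $n$-tuple $(A_1,\dots,A_n)$ of nonempty compact sets (the components of the attractor) with $A_i=\bigcup_{e\in E_i}f_e(A_{e^+})$ for all $i$. Standing assumptions: each $A_i$ has nonempty interior, and for each $i$ and distinct $e,e'\in E_i$ the set $f_e(A_{e^+})\cap f_{e'}(A_{e'^+})$ has empty interior. Tilings. A tile is a compact subset of $\mathbb{R}^d$ with nonempty interior; a tiling of $X\subseteq\mathbb{R}^d$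 is a set of tiles, pairwise non-overlapping (the intersection of two distinct tiles has empty interior), whose union is $X$. Pre-trees. A subpath of $\sigma_1\cdots\sigma_k$ is an initial segment $\sigma_1\cdots\sigma_j$ with $0\le j\le k$ (for $j=0$, the single starting vertex); it is proper if $j<k$. A pre-tree is a finite nonempty set $S$ of finite paths in $G$ such that (i) all paths in $S$ begin at the same vertex, the root of $S$; (ii) no proper subpath of a path in $S$ lies in $S$; (iii) if $\sigma$ is a proper subpath of a path in $S$ and $e\in E$ has $e^-=\sigma^+$, then $\sigma e$ is a subpath of a path in $S$. Parameters. Let $\overleftarrow{G}$ be $G$ with all edges reversed, $\overleftarrow{e}$ the reversal of $e$, $\overleftarrow{\Sigma}^*$ and $\overleftarrow{\Sigma}^\infty$ the sets of finite and infinite paths in $\overleftarrow{G}$, $f_{\overleftarrow{e}}=f_e^{-1}$, and $f_{\overleftarrow{e_1}\cdots\overleftarrow{e_k}}=f_{\overleftarrow{e_1}}\circ\cdots\circ f_{\overleftarrow{e_k}}$. A parameter is an element $\overleftarrow{\theta}=\overleftarrow{\theta}_1\overleftarrow{\theta}_2\cdots$ of $\overleftarrow{\Sigma}^\infty$, with successive vertices $v_0,v_1,v_2,\dots$; $\theta_k\in E$ is the edge of $G$ with reversal $\overleftarrow{\theta}_k$ (so $\theta_k$ goes from $v_k$ to $v_{k-1}$), and $\overleftarrow{\theta}|k=\overleftarrow{\theta}_1\cdots\overleftarrow{\theta}_k$. A $\overleftarrow{\theta}$-sequence is a sequence $\mathcal{S}=\{S_0,S_1,\dots\}$ of pre-trees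 such that $S_k$ has root $v_k$ for all $k\ge0$ and $\theta_kS_{k-1}:=\{\theta_k\sigma:\sigma\in S_{k-1}\}\subset S_k$ for all $k\ge1$. Put $T(\overleftarrow{\theta},\mathcal{S},k)=\{f_{\overleftarrow{\theta}|k}\circ f_\sigma(A_{\sigma^+}):\sigma\in S_k\}$ and $T(\overleftarrow{\theta},\mathcal{S})=\bigcup_{k\ge0}T(\overleftarrow{\theta},\mathcal{S},k)$. The parameter $\overleftarrow{\theta}$ is filling if, for every $\overleftarrow{\theta}$-sequence $\mathcal{S}$, the union of the sets in $T(\overleftarrow{\theta},\mathcal{S})$ is $\mathbb{R}^d$. *)

theory Defs
  imports "HOL-Analysis.Analysis" "HOL-Library.Sublist" "Graph_Theory.Graph_Theory"
begin

text \<open>A finite path is a pair of its starting vertex and its list of edges, so that there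
  is one path of length zero for each vertex. Loops and multiple edges are allowed by
  \<^locale>\<open>fin_digraph\<close>.\<close>

type_synonym ('v, 'e) fpath = "'v \<times> 'e list"

definition finite_paths :: "('v, 'e) pre_digraph \<Rightarrow> ('v, 'e) fpath set" where
  "finite_paths G = {(u, p). \<exists>v. pre_digraph.awalk G u p v}"

abbreviation path_start :: "('v, 'e) fpath \<Rightarrow> 'v" where
  "path_start \<sigma> \<equiv> fst \<sigma>"

definition path_end :: "('v, 'e) pre_digraph \<Rightarrow> ('v, 'e) fpath \<Rightarrow> 'v" where
  "path_end G \<sigma> = pre_digraph.awlast G (fst \<sigma>) (snd \<sigma>)"

definition subpath :: "('v, 'e) fpath \<Rightarrow> ('v, 'e) fpath \<Rightarrow> bool" where
  "subpath \<tau> \<sigma> \<longleftrightarrow> path_start \<tau> = path_start \<sigma> \<and> prefix (snd \<tau>) (snd \<sigma>)"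

definition proper_subpath :: "('v, 'e) fpath \<Rightarrow> ('v, 'e) fpath \<Rightarrow> bool" where
  "proper_subpath \<tau> \<sigma> \<longleftrightarrow> path_start \<tau> = path_start \<sigma> \<and> strict_prefix (snd \<tau>) (snd \<sigma>)"

definition path_snoc :: "('v, 'e) fpath \<Rightarrow> 'e \<Rightarrow> ('v, 'e) fpath" where
  "path_snoc \<sigma> e = (path_start \<sigma>, snd \<sigma> @ [e])"

text \<open>The edge \<open>e\<close> prepended to \<open>\<sigma>\<close>; a path only if \<open>head G e = path_start \<sigma>\<close>.\<close>

definition path_cons :: "('v, 'e) pre_digraph \<Rightarrow> 'e \<Rightarrow> ('v, 'e) fpath \<Rightarrow> ('v, 'e) fpath" where
  "path_cons G e \<sigma> = (tail G e, e # snd \<sigma>)"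

definition pre_tree :: "('v, 'e) pre_digraph \<Rightarrow> 'v \<Rightarrow> ('v, 'e) fpath set \<Rightarrow> bool" where
  "pre_tree G r S \<longleftrightarrow>
     finite S \<and> S \<noteq> {} \<and> S \<subseteq> finite_paths G \<and>
     (\<forall>\<sigma>\<in>S. path_start \<sigma> = r) \<and>
     (\<forall>\<sigma>\<in>S. \<forall>\<tau>. proper_subpath \<tau> \<sigma> \<longrightarrow> \<tau> \<notin> S) \<and>
     (\<forall>\<sigma>\<in>S. \<forall>\<tau>. proper_subpath \<tau> \<sigma> \<longrightarrow>
        (\<forall>e\<in>out_arcs G (path_end G \<tau>). \<exists>\<rho>\<in>S. subpath (path_snoc \<tau> e) \<rho>))"

definition contraction :: "('a::metric_space \<Rightarrow> 'a) \<Rightarrow> bool" where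
  "contraction g \<longleftrightarrow> (\<exists>c<1. c-lipschitz_on UNIV g)"

locale gifs = fin_digraph G
  for G :: "('v, 'e) pre_digraph" +
  fixes f :: "'e \<Rightarrow> real ^ 'd \<Rightarrow> real ^ 'd"
  assumes strongly_connected: "strongly_connected G"
    and invertible: "e \<in> arcs G \<Longrightarrow> bij (f e)"
    and contraction: "e \<in> arcs G \<Longrightarrow> contraction (f e)"

definition is_attractor ::
  "('v, 'e) pre_digraph \<Rightarrow> ('e \<Rightarrow> real ^ 'd \<Rightarrow> real ^ 'd) \<Rightarrow> ('v \<Rightarrow> (real ^ 'd) set) \<Rightarrow> bool" where
  "is_attractor G f A \<longleftrightarrow>
     (\<forall>i\<in>verts G. A i \<noteq> {} \<and> compact (A i) \<and> A i = (\<Union>e\<in>out_arcs G i. f e ` A (head G e)))"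

text \<open>\<open>A\<close> is the attractor of the GIFS, fixed together with its defining property (which
  determines it uniquely on the vertices). Values of \<open>f\<close> and \<open>A\<close> outside the edges and
  vertices of \<open>G\<close> are irrelevant.\<close>

locale tiling_gifs = gifs G f
  for G :: "('v, 'e) pre_digraph" and f :: "'e \<Rightarrow> real ^ 'd \<Rightarrow> real ^ 'd" +
  fixes A :: "'v \<Rightarrow> (real ^ 'd) set"
  assumes attractor: "is_attractor G f A"
    and interior_nonempty: "i \<in> verts G \<Longrightarrow> interior (A i) \<noteq> {}"
    and non_overlapping:
      "\<lbrakk>i \<in> verts G; e \<in> out_arcs G i; e' \<in> out_arcs G i; e \<noteq> e'\<rbrakk>
        \<Longrightarrow> interior (f e ` A (head G e) \<inter> f e' ` A (head G e')) = {}"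

definition tile :: "(real ^ 'd) set \<Rightarrow> bool" where
  "tile t \<longleftrightarrow> compact t \<and> interior t \<noteq> {}"

definition is_tiling :: "(real ^ 'd) set set \<Rightarrow> (real ^ 'd) set \<Rightarrow> bool" where
  "is_tiling T X \<longleftrightarrow>
     (\<forall>t\<in>T. tile t) \<and> pairwise (\<lambda>s t. interior (s \<inter> t) = {}) T \<and> \<Union>T = X"

definition path_map :: "('e \<Rightarrow> 'a \<Rightarrow> 'a) \<Rightarrow> 'e list \<Rightarrow> 'a \<Rightarrow> 'a" where
  "path_map f p = foldr (\<lambda>e h. f e \<circ> h) p id"

text \<open>The reversal of an edge \<open>e\<close> of \<open>G\<close> is the same \<open>e\<close>, regarded as an edge of
  \<open>rev_digraph G\<close>.\<close>

definition rev_digraph :: "('v, 'e) pre_digraph \<Rightarrow> ('v, 'e) pre_digraph" where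
  "rev_digraph G = \<lparr>verts = verts G, arcs = arcs G, tail = head G, head = tail G\<rparr>"

text \<open>Infinite paths are indexed from 0: \<open>\<theta> k\<close> is the edge from the \<open>k\<close>-th to the
  \<open>(k + 1)\<close>-st vertex (usually written with index \<open>k + 1\<close>), so the \<open>k\<close>-th vertex is the
  tail of \<open>\<theta> k\<close>.\<close>

definition infinite_paths :: "('v, 'e) pre_digraph \<Rightarrow> (nat \<Rightarrow> 'e) set" where
  "infinite_paths H = {\<theta>. \<forall>k. \<theta> k \<in> arcs H \<and> head H (\<theta> k) = tail H (\<theta> (Suc k))}"

definition infinite_path_vertex :: "('v, 'e) pre_digraph \<Rightarrow> (nat \<Rightarrow> 'e) \<Rightarrow> nat \<Rightarrow> 'v" where
  "infinite_path_vertex H \<theta> k = tail H (\<theta> k)"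

definition parameters :: "('v, 'e) pre_digraph \<Rightarrow> (nat \<Rightarrow> 'e) set" where
  "parameters G = infinite_paths (rev_digraph G)"

definition theta_sequence ::
  "('v, 'e) pre_digraph \<Rightarrow> (nat \<Rightarrow> 'e) \<Rightarrow> (nat \<Rightarrow> ('v, 'e) fpath set) \<Rightarrow> bool" where
  "theta_sequence G \<theta> S \<longleftrightarrow>
     (\<forall>k. pre_tree G (infinite_path_vertex (rev_digraph G) \<theta> k) (S k)) \<and>
     (\<forall>k. path_cons G (\<theta> k) ` S k \<subseteq> S (Suc k))"

definition backward_map ::
  "('e \<Rightarrow> real ^ 'd \<Rightarrow> real ^ 'd) \<Rightarrow> (nat \<Rightarrow> 'e) \<Rightarrow> nat \<Rightarrow> real ^ 'd \<Rightarrow> real ^ 'd" where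
  "backward_map f \<theta> k = path_map (\<lambda>e. inv (f e)) (map \<theta> [0..<k])"

definition tiles_at ::
  "('v, 'e) pre_digraph \<Rightarrow> ('e \<Rightarrow> real ^ 'd \<Rightarrow> real ^ 'd) \<Rightarrow> ('v \<Rightarrow> (real ^ 'd) set) \<Rightarrow>
    (nat \<Rightarrow> 'e) \<Rightarrow> (nat \<Rightarrow> ('v, 'e) fpath set) \<Rightarrow> nat \<Rightarrow> (real ^ 'd) set set" where
  "tiles_at G f A \<theta> S k =
     {(backward_map f \<theta> k \<circ> path_map f (snd \<sigma>)) ` A (path_end G \<sigma>) | \<sigma>. \<sigma> \<in> S k}"

definition tiles ::
  "('v, 'e) pre_digraph \<Rightarrow> ('e \<Rightarrow> real ^ 'd \<Rightarrow> real ^ 'd) \<Rightarrow> ('v \<Rightarrow> (real ^ 'd) set) \<Rightarrow>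
    (nat \<Rightarrow> 'e) \<Rightarrow> (nat \<Rightarrow> ('v, 'e) fpath set) \<Rightarrow> (real ^ 'd) set set" where
  "tiles G f A \<theta> S = (\<Union>k. tiles_at G f A \<theta> S k)"

definition filling ::
  "('v, 'e) pre_digraph \<Rightarrow> ('e \<Rightarrow> real ^ 'd \<Rightarrow> real ^ 'd) \<Rightarrow> ('v \<Rightarrow> (real ^ 'd) set) \<Rightarrow>
    (nat \<Rightarrow> 'e) \<Rightarrow> bool" where
  "filling G f A \<theta> \<longleftrightarrow> (\<forall>S. theta_sequence G \<theta> S \<longrightarrow> \<Union>(tiles G f A \<theta> S) = UNIV)"

end

theory Submission
  imports Defs
begin

text \<open>The filling hypothesis says that the tiles cover the space, so only two points remain: every
  member of the collection is a tile, and no two of them overlap. The maps \<open>f e\<close> are continuous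
  bijections of a Euclidean space, and by invariance of domain such maps are homeomorphisms; hence
  compositions of the \<open>f e\<close> and their inverses preserve compactness and commute with interiors.
  This makes every member the homeomorphic image of a component of the attractor, hence a tile
  (\<open>tile_homeomorphic_image\<close>).

  Two paths of one pre-tree leave the root together and separate at some vertex along two
  different edges \<open>e\<close> and \<open>e'\<close>, because neither extends the other. Iterating the attractor equation
  puts their images inside the images of \<open>f e ` A (head G e)\<close> and \<open>f e' ` A (head G e')\<close> under one
  common homeomorphism, and those do not overlap (\<open>pre_tree_images_non_overlapping\<close>). Passing from
  level \<open>k\<close> to level \<open>k + 1\<close> prepends \<open>\<theta> k\<close> to the paths and appends the inverse of \<open>f (\<theta> k)\<close> to
  the backward map; the two cancel, so the levels increase (\<open>tiles_at_mono\<close>). Any two tiles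
  therefore already occur on a common level, where they come from one pre-tree.\<close>

section \<open>Homeomorphisms of Euclidean space\<close>

definition self_homeomorphism :: "(real ^ 'd \<Rightarrow> real ^ 'd) \<Rightarrow> bool" where
  "self_homeomorphism g \<longleftrightarrow> bij g \<and> continuous_on UNIV g \<and> continuous_on UNIV (inv g)"

lemma self_homeomorphism_id: "self_homeomorphism id"
  by (simp add: self_homeomorphism_def)

lemma self_homeomorphism_comp:
  assumes "self_homeomorphism g" "self_homeomorphism h"
  shows "self_homeomorphism (g \<circ> h)"
proof -
  have "inv (g \<circ> h) = inv h \<circ> inv g"
    using assms by (simp add: self_homeomorphism_def o_inv_distrib)
  moreover have "continuous_on UNIV (p \<circ> q)"
    if "continuous_on UNIV p" "continuous_on UNIV q" for p q :: "real ^ 'd \<Rightarrow> real ^ 'd"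
    using that by (meson continuous_on_compose continuous_on_subset subset_UNIV)
  ultimately show ?thesis
    using assms unfolding self_homeomorphism_def by (metis bij_comp)
qed

lemma self_homeomorphism_inv: "self_homeomorphism g \<Longrightarrow> self_homeomorphism (inv g)"
  by (simp add: self_homeomorphism_def bij_imp_bij_inv inv_inv_eq)

text \<open>Invariance of domain makes a continuous bijection of a Euclidean space an open map.\<close>

lemma self_homeomorphismI:
  assumes "bij g" "continuous_on UNIV g"
  shows "self_homeomorphism g"
proof -
  have "continuous_on (g ` UNIV) (inv g)"
  proof (rule continuous_on_inverse_open_map)
    show "openin (top_of_set (g ` UNIV)) (g ` U)" if "openin (top_of_set UNIV) U" for U
      using that assms invariance_of_domain[of U g]
      by (auto simp: bij_is_surj intro: continuous_on_subset inj_on_subset[OF bij_is_inj])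
  qed (use assms in \<open>auto simp: bij_is_inj\<close>)
  then show ?thesis
    using assms by (simp add: self_homeomorphism_def bij_is_surj)
qed

lemma interior_homeomorphic_image:
  assumes "self_homeomorphism g"
  shows "interior (g ` X) = g ` interior X"
proof -
  have sub: "h ` interior Y \<subseteq> interior (h ` Y)"
    if h: "self_homeomorphism h" for h :: "real ^ 'd \<Rightarrow> real ^ 'd" and Y
  proof (rule interior_maximal)
    show "open (h ` interior Y)"
      using h unfolding self_homeomorphism_def
      by (meson bij_is_inj continuous_on_subset inj_on_subset invariance_of_domain open_interior
          subset_UNIV)
  qed (simp add: image_mono interior_subset)
  \<comment> \<open>The converse inclusion is the first one for the inverse.\<close>
  have "inv g ` interior (g ` X) \<subseteq> interior (inv g ` g ` X)"
    by (rule sub[OF self_homeomorphism_inv[OF assms]])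
  also have "inv g ` g ` X = X"
    using assms by (simp add: self_homeomorphism_def bij_is_inj)
  finally have "g ` inv g ` interior (g ` X) \<subseteq> g ` interior X"
    by (rule image_mono)
  then have "interior (g ` X) \<subseteq> g ` interior X"
    using assms by (simp add: self_homeomorphism_def bij_is_surj image_f_inv_f)
  then show ?thesis
    using sub[OF assms] by blast
qed

lemma tile_homeomorphic_image:
  assumes "self_homeomorphism g" "tile t"
  shows "tile (g ` t)"
  using assms interior_homeomorphic_image[OF assms(1), of t]
  by (auto simp: tile_def self_homeomorphism_def
      intro: compact_continuous_image continuous_on_subset)

lemma non_overlapping_homeomorphic_image:
  assumes "self_homeomorphism g" "interior (X \<inter> Y) = {}"
  shows "interior (g ` X \<inter> g ` Y) = {}"
  using assms interior_homeomorphic_image[OF assms(1), of "X \<inter> Y"]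
  by (simp add: image_Int self_homeomorphism_def bij_is_inj)

section \<open>Maps along paths and the levels of the tiling\<close>

lemma path_map_Nil [simp]: "path_map f [] = id"
  by (simp add: path_map_def)

lemma path_map_Cons [simp]: "path_map f (e # p) = f e \<circ> path_map f p"
  by (simp add: path_map_def)

lemma path_map_append: "path_map f (p @ q) = path_map f p \<circ> path_map f q"
  by (induction p) (simp_all add: o_assoc)

lemma self_homeomorphism_path_map:
  assumes "\<And>e. e \<in> set p \<Longrightarrow> self_homeomorphism (f e)"
  shows "self_homeomorphism (path_map f p)"
  using assms by (induction p) (auto simp: self_homeomorphism_id intro: self_homeomorphism_comp)

lemma backward_map_Suc: "backward_map f \<theta> (Suc k) = backward_map f \<theta> k \<circ> inv (f (\<theta> k))"
  by (simp add: backward_map_def path_map_append)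

text \<open>The root being shared, comparable edge lists would make one path a proper subpath of the
  other, and a pre-tree contains no proper subpath of its members.\<close>

lemma pre_tree_parallel:
  assumes "pre_tree G r S" "\<sigma> \<in> S" "\<tau> \<in> S" "\<sigma> \<noteq> \<tau>"
  shows "snd \<sigma> \<parallel> snd \<tau>"
  using assms unfolding pre_tree_def proper_subpath_def parallel_def strict_prefix_def
  by (metis prod_eq_iff)

context gifs
begin

lemma self_homeomorphism_edge_map:
  assumes "e \<in> arcs G"
  shows "self_homeomorphism (f e)"
proof -
  obtain c where "c-lipschitz_on UNIV (f e)"
    using contraction[OF assms] by (auto simp: contraction_def)
  then show ?thesis
    by (intro self_homeomorphismI invertible[OF assms] lipschitz_on_continuous_on)
qed

lemma self_homeomorphism_walk_map:
  assumes "awalk u p v"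
  shows "self_homeomorphism (path_map f p)"
  using assms by (intro self_homeomorphism_path_map self_homeomorphism_edge_map) (auto simp: awalk_def)

lemma parameter_arc: "\<theta> \<in> parameters G \<Longrightarrow> \<theta> k \<in> arcs G"
  by (simp add: parameters_def infinite_paths_def rev_digraph_def)

lemma self_homeomorphism_backward_map:
  assumes "\<theta> \<in> parameters G"
  shows "self_homeomorphism (backward_map f \<theta> k)"
  unfolding backward_map_def
  using parameter_arc[OF assms]
  by (auto intro!: self_homeomorphism_path_map self_homeomorphism_inv self_homeomorphism_edge_map)

lemma finite_pathsD: "\<sigma> \<in> finite_paths G \<Longrightarrow> awalk (path_start \<sigma>) (snd \<sigma>) (path_end G \<sigma>)"
  by (auto simp: finite_paths_def path_end_def)

text \<open>The tile of \<open>\<sigma>\<close> on level \<open>k\<close> reappears on level \<open>k + 1\<close> as the tile of \<open>\<theta> k\<close> followed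
  by \<open>\<sigma>\<close>, since the new factors \<open>inv (f (\<theta> k))\<close> and \<open>f (\<theta> k)\<close> cancel.\<close>

lemma tiles_at_Suc:
  assumes "\<theta> \<in> parameters G" "theta_sequence G \<theta> S"
  shows "tiles_at G f A \<theta> S k \<subseteq> tiles_at G f A \<theta> S (Suc k)"
proof
  fix t
  assume "t \<in> tiles_at G f A \<theta> S k"
  then obtain \<sigma> where \<sigma>: "\<sigma> \<in> S k"
    and t: "t = (backward_map f \<theta> k \<circ> path_map f (snd \<sigma>)) ` A (path_end G \<sigma>)"
    by (auto simp: tiles_at_def)
  let ?\<tau> = "path_cons G (\<theta> k) \<sigma>"
  have tree: "pre_tree G (infinite_path_vertex (rev_digraph G) \<theta> k) (S k)"
    and \<tau>: "?\<tau> \<in> S (Suc k)"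
    using assms(2) \<sigma> by (auto simp: theta_sequence_def)
  \<comment> \<open>Needed when \<open>\<sigma>\<close> has length zero, since its end is then read off from its start.\<close>
  have "path_start \<sigma> = head G (\<theta> k)"
    using tree \<sigma> by (auto simp: pre_tree_def infinite_path_vertex_def rev_digraph_def)
  then have "path_end G ?\<tau> = path_end G \<sigma>"
    by (simp add: path_end_def path_cons_def awalk_verts_ne_eq)
  moreover have "inv (f (\<theta> k)) \<circ> f (\<theta> k) = id"
    using invertible[OF parameter_arc[OF assms(1)]] by (simp add: bij_is_inj)
  then have "backward_map f \<theta> (Suc k) \<circ> path_map f (snd ?\<tau>)
      = backward_map f \<theta> k \<circ> path_map f (snd \<sigma>)"
    by (simp add: backward_map_Suc path_cons_def fun_eq_iff)
  ultimately show "t \<in> tiles_at G f A \<theta> S (Suc k)"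
    using \<tau> t unfolding tiles_at_def mem_Collect_eq by metis
qed

lemma tiles_at_mono:
  assumes "\<theta> \<in> parameters G" "theta_sequence G \<theta> S" "j \<le> k"
  shows "tiles_at G f A \<theta> S j \<subseteq> tiles_at G f A \<theta> S k"
  using lift_Suc_mono_le[of "tiles_at G f A \<theta> S", OF tiles_at_Suc[OF assms(1,2)] assms(3)] .

end

section \<open>Tiles from the attractor\<close>

context tiling_gifs
begin

lemma tile_component: "i \<in> verts G \<Longrightarrow> tile (A i)"
  using attractor interior_nonempty unfolding tile_def is_attractor_def by metis

text \<open>The attractor equation, iterated along a walk.\<close>

lemma walk_image_subset:
  assumes "awalk u p v"
  shows "path_map f p ` A v \<subseteq> A u"
  using assms
proof (induction p arbitrary: u)
  case Nil
  then show ?case by (simp add: awalk_Nil_iff)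
next
  case (Cons e p)
  then have e: "e \<in> out_arcs G u" and IH: "path_map f p ` A v \<subseteq> A (head G e)" and "u \<in> verts G"
    by (auto simp: awalk_Cons_iff)
  have "path_map f (e # p) ` A v = f e ` path_map f p ` A v"
    by (simp add: image_comp)
  also have "\<dots> \<subseteq> f e ` A (head G e)"
    using IH by (rule image_mono)
  also have "\<dots> \<subseteq> A u"
  proof -
    have "A u = (\<Union>e\<in>out_arcs G u. f e ` A (head G e))"
      using attractor \<open>u \<in> verts G\<close> unfolding is_attractor_def by metis
    then show ?thesis
      using e by (metis UN_upper)
  qed
  finally show ?case .
qed

text \<open>At the vertex where two paths of a pre-tree separate, each image lies in the piece
  of the attractor equation belonging to its next edge, up to the map of the common part.\<close>

lemma pre_tree_images_non_overlapping:
  assumes tree: "pre_tree G r S" and "\<sigma> \<in> S" "\<tau> \<in> S" "\<sigma> \<noteq> \<tau>"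
  shows "interior (path_map f (snd \<sigma>) ` A (path_end G \<sigma>)
    \<inter> path_map f (snd \<tau>) ` A (path_end G \<tau>)) = {}"
proof -
  obtain p e e' q q' where ne: "e \<noteq> e'"
    and \<sigma>: "snd \<sigma> = p @ e # q" and \<tau>: "snd \<tau> = p @ e' # q'"
    using parallel_decomp[OF pre_tree_parallel[OF assms]] by blast
  have walks: "awalk r (snd \<sigma>) (path_end G \<sigma>)" "awalk r (snd \<tau>) (path_end G \<tau>)"
    using tree finite_pathsD[of \<sigma>] finite_pathsD[of \<tau>] \<open>\<sigma> \<in> S\<close> \<open>\<tau> \<in> S\<close>
    by (auto simp: pre_tree_def)
  define w where "w = awlast r p"
  have p: "awalk r p w" and e: "awalk w (e # q) (path_end G \<sigma>)"
    and e': "awalk w (e' # q') (path_end G \<tau>)"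
    using walks unfolding \<sigma> \<tau> w_def by auto
  have branch: "path_map f (p @ a # s) ` A v \<subseteq> path_map f p ` f a ` A (head G a)"
    if "awalk w (a # s) v" for a s v
    using that walk_image_subset[of "head G a" s v]
    by (auto simp: path_map_append awalk_Cons_iff)
  have "w \<in> verts G" "e \<in> out_arcs G w" "e' \<in> out_arcs G w"
    using e e' by (auto simp: awalk_Cons_iff)
  then have "interior (path_map f p ` f e ` A (head G e) \<inter> path_map f p ` f e' ` A (head G e')) = {}"
    by (intro non_overlapping_homeomorphic_image self_homeomorphism_walk_map[OF p]
        non_overlapping ne)
  then show ?thesis
    using interior_mono[OF Int_mono[OF branch[OF e] branch[OF e']]] by (simp add: \<sigma> \<tau>)
qed

lemma tiles_at_non_overlapping:
  assumes "\<theta> \<in> parameters G" "theta_sequence G \<theta> S"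
    and "s \<in> tiles_at G f A \<theta> S k" "t \<in> tiles_at G f A \<theta> S k" "s \<noteq> t"
  shows "interior (s \<inter> t) = {}"
proof -
  obtain \<sigma> \<tau> where "\<sigma> \<in> S k" "\<tau> \<in> S k"
    and s: "s = backward_map f \<theta> k ` path_map f (snd \<sigma>) ` A (path_end G \<sigma>)"
    and t: "t = backward_map f \<theta> k ` path_map f (snd \<tau>) ` A (path_end G \<tau>)"
    using assms(3,4) unfolding tiles_at_def mem_Collect_eq image_comp[symmetric] by metis
  with \<open>s \<noteq> t\<close> have \<sigma>\<tau>: "\<sigma> \<in> S k" "\<tau> \<in> S k" "\<sigma> \<noteq> \<tau>"
    by auto
  have "pre_tree G (infinite_path_vertex (rev_digraph G) \<theta> k) (S k)"
    using assms(2) by (simp add: theta_sequence_def)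
  from pre_tree_images_non_overlapping[OF this \<sigma>\<tau>] show ?thesis
    unfolding s t
    by (rule non_overlapping_homeomorphic_image[OF self_homeomorphism_backward_map[OF assms(1)]])
qed

lemma tile_tiles_at:
  assumes "\<theta> \<in> parameters G" "theta_sequence G \<theta> S" "t \<in> tiles_at G f A \<theta> S k"
  shows "tile t"
proof -
  obtain \<sigma> where "\<sigma> \<in> S k"
    and t: "t = (backward_map f \<theta> k \<circ> path_map f (snd \<sigma>)) ` A (path_end G \<sigma>)"
    using assms(3) by (auto simp: tiles_at_def)
  then have "\<sigma> \<in> finite_paths G"
    using assms(2) unfolding theta_sequence_def pre_tree_def by blast
  then have "awalk (path_start \<sigma>) (snd \<sigma>) (path_end G \<sigma>)"
    by (rule finite_pathsD)
  then show ?thesis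
    unfolding t
    by (intro tile_homeomorphic_image self_homeomorphism_comp tile_component
        self_homeomorphism_backward_map[OF assms(1)] self_homeomorphism_walk_map)
      auto
qed

end

theorem theorem3:
  fixes G :: "('v, 'e) pre_digraph"
    and f :: "'e \<Rightarrow> real ^ 'd \<Rightarrow> real ^ 'd"
    and A :: "'v \<Rightarrow> (real ^ 'd) set"
    and \<theta> :: "nat \<Rightarrow> 'e"
  assumes "tiling_gifs G f A"
    and "\<theta> \<in> parameters G"
    and "filling G f A \<theta>"
  shows "\<forall>S. theta_sequence G \<theta> S \<longrightarrow> is_tiling (tiles G f A \<theta> S) UNIV"
proof (intro allI impI)
  fix S
  assume S: "theta_sequence G \<theta> S"
  interpret tiling_gifs G f A by fact
  have "tile t" if "t \<in> tiles G f A \<theta> S" for t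
    using that tile_tiles_at[OF assms(2) S] by (auto simp: tiles_def)
  moreover have "interior (s \<inter> t) = {}"
    if st: "s \<in> tiles G f A \<theta> S" "t \<in> tiles G f A \<theta> S" "s \<noteq> t" for s t
  proof -
    obtain j k where "s \<in> tiles_at G f A \<theta> S j" "t \<in> tiles_at G f A \<theta> S k"
      using st by (auto simp: tiles_def)
    then have "s \<in> tiles_at G f A \<theta> S (max j k)" "t \<in> tiles_at G f A \<theta> S (max j k)"
      using tiles_at_mono[OF assms(2) S] by (meson max.cobounded1 max.cobounded2 subsetD)+
    then show ?thesis
      using tiles_at_non_overlapping[OF assms(2) S] \<open>s \<noteq> t\<close> by blast
  qed
  moreover have "\<Union>(tiles G f A \<theta> S) = UNIV"
    using assms(3) S by (simp add: filling_def)
  ultimately show "is_tiling (tiles G f A \<theta> S) UNIV"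
    by (simp add: is_tiling_def pairwise_def)
qed

end
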